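(* Let $B\geq 2$ and let $a_1,\dots,a_r\geq 0$ be integers. Then $$s_B\left( \sum_{i=1}^{r} a_i \right)=\sum_{i=1}^{r }s_B(a_i)- \widehat{c}_B\left( a_1,a_2,\dots,a_r \right),$$ where $\widehat{c}_B(a_1,\dots,a_r):=\beta-s_B(\beta)+(B-1)c_B(a_1,\dots,a_r)$.
   Context: For an integer $a\geq 0$, $s_B(a)$ is the sum of its base-$B$ digits ($s_B(0)=0$). Write each $a_i=\sum_{j\ge 0}\alpha_{i,j}B^j$ with digits $0\le \alpha_{i,j}<B$, and let $t\ge 0$ be the largest exponent $j$ such that some $\alpha_{i,j}\neq 0$ (take $t=0$ if all $a_i=0$). The carries of the traditional base-$B$ column addition algorithm for $a_1+\dots+a_r$ are $\delta_0=\lfloor(\alpha_{1,0}+\dots+\alpha_{r,0})/B\rfloor$ and $\delta_j=\lfloor(\alpha_{1,j}+\dots+\alpha_{r,j}+\delta_{j-1})/B\rfloor$ for $1\le j\le t$. The carry sum is $c_B(a_1,\dots,a_r)=\sum_{j=0}^{t}\delta_j$ and the terminal carry (the carry left over from the left-most column, which is brought down to form the left-most digits of the sum) is $\beta=\delta_t$. *)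

theory Defs
  imports Main
begin

definition digit :: "nat \<Rightarrow> nat \<Rightarrow> nat \<Rightarrow> nat" where
  "digit B a j = (a div B ^ j) mod B"

text \<open>The next three facts show that, for \<open>B \<ge> 2\<close>, the numbers \<open>digit B a j\<close> are the
  base-\<open>B\<close> digits of \<open>a\<close>, and that the sum and the maximum below range over finite sets.\<close>

lemma digit_less: "2 \<le> B \<Longrightarrow> digit B a j < B"
  by (simp add: digit_def)

lemma finite_digit_support:
  assumes "2 \<le> B"
  shows "finite {j. digit B a j \<noteq> 0}"
proof (rule finite_subset)
  show "{j. digit B a j \<noteq> 0} \<subseteq> {..a}"
  proof
    fix j assume "j \<in> {j. digit B a j \<noteq> 0}"
    then have "B ^ j \<le> a"
      unfolding digit_def by (metis (mono_tags) div_less mem_Collect_eq mod_0 not_le)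
    moreover have "j < B ^ j"
      using assms by (intro power_gt_expt) simp
    ultimately show "j \<in> {..a}" by simp
  qed
qed simp

lemma digit_expansion:
  assumes "2 \<le> B"
  shows "a = (\<Sum>j | digit B a j \<noteq> 0. digit B a j * B ^ j)"
proof -
  have split: "a = (\<Sum>j<n. digit B a j * B ^ j) + B ^ n * (a div B ^ n)" for n
  proof (induction n)
    case (Suc n)
    have "a div B ^ n = B * (a div B ^ Suc n) + digit B a n"
      by (simp add: digit_def div_mult2_eq mult.commute[of B])
    then have "B ^ n * (a div B ^ n) = B ^ Suc n * (a div B ^ Suc n) + digit B a n * B ^ n"
      by (simp add: algebra_simps)
    with Suc show ?case by simp
  qed simp
  obtain n where n: "a < B ^ n" "{j. digit B a j \<noteq> 0} \<subseteq> {..<n}"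
  proof -
    obtain m where m: "{j. digit B a j \<noteq> 0} \<subseteq> {..<m}"
      using finite_digit_support[OF assms, of a] unfolding finite_nat_set_iff_bounded by blast
    have "a + m < B ^ (a + m)"
      using assms by (intro power_gt_expt) simp
    with m that[of "a + m"] show thesis by fastforce
  qed
  have "a = (\<Sum>j<n. digit B a j * B ^ j)"
    using split[of n] n(1) by simp
  also have "\<dots> = (\<Sum>j | digit B a j \<noteq> 0. digit B a j * B ^ j)"
    using n(2) by (intro sum.mono_neutral_right) auto
  finally show ?thesis .
qed

definition digit_sum :: "nat \<Rightarrow> nat \<Rightarrow> nat" where
  "digit_sum B a = (\<Sum>j | digit B a j \<noteq> 0. digit B a j)"

text \<open>Throughout, a tuple \<open>a\<^sub>1, \<dots>, a\<^sub>r\<close> is given by its length \<open>r\<close> and a function \<open>a\<close>,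
  of which only the values on \<open>{1..r}\<close> matter.\<close>

definition top_exponent :: "nat \<Rightarrow> nat \<Rightarrow> (nat \<Rightarrow> nat) \<Rightarrow> nat" where
  "top_exponent B r a =
     (if \<forall>i\<in>{1..r}. a i = 0 then 0
      else Max {j. \<exists>i\<in>{1..r}. digit B (a i) j \<noteq> 0})"

primrec carry :: "nat \<Rightarrow> nat \<Rightarrow> (nat \<Rightarrow> nat) \<Rightarrow> nat \<Rightarrow> nat" where
  "carry B r a 0 = (\<Sum>i=1..r. digit B (a i) 0) div B"
| "carry B r a (Suc j) = ((\<Sum>i=1..r. digit B (a i) (Suc j)) + carry B r a j) div B"

definition carry_sum :: "nat \<Rightarrow> nat \<Rightarrow> (nat \<Rightarrow> nat) \<Rightarrow> nat" where
  "carry_sum B r a = (\<Sum>j=0..top_exponent B r a. carry B r a j)"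

definition terminal_carry :: "nat \<Rightarrow> nat \<Rightarrow> (nat \<Rightarrow> nat) \<Rightarrow> nat" where
  "terminal_carry B r a = carry B r a (top_exponent B r a)"

definition carry_hat :: "nat \<Rightarrow> nat \<Rightarrow> (nat \<Rightarrow> nat) \<Rightarrow> int" where
  "carry_hat B r a =
     int (terminal_carry B r a) - int (digit_sum B (terminal_carry B r a))
     + (int B - 1) * int (carry_sum B r a)"

end

theory Submission
  imports Defs
begin

text \<open>In each column the digit of the sum is the column total plus the incoming carry minus
  \<open>B\<close> times the outgoing carry. Summed over the columns \<open>0, \<dots>, t\<close> the carries telescope to
  \<open>- \<delta>\<^sub>t - (B - 1) (\<delta>\<^sub>0 + \<dots> + \<delta>\<^sub>t)\<close>. The digits of the sum beyond column \<open>t\<close> are those of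
  \<open>\<beta> = \<delta>\<^sub>t\<close>, since the quotient of the sum by \<open>B ^ (t + 1)\<close> is \<open>\<beta>\<close>; they contribute \<open>s\<^sub>B(\<beta>)\<close>.\<close>

lemma digit_div_power: "digit B (a div B ^ n) j = digit B a (n + j)"
  by (simp add: digit_def div_mult2_eq power_add)

lemma div_power_eq_digit_plus: "a div B ^ n = digit B a n + B * (a div B ^ Suc n)"
  by (simp add: digit_def div_mult2_eq power_Suc2 del: power_Suc)

lemma eq_0_if_digits_eq_0:
  assumes "2 \<le> B" and "\<And>j. digit B a j = 0"
  shows "a = 0"
  using digit_expansion[OF assms(1), of a] assms(2) by simp

text \<open>Dividing by \<open>B ^ n\<close> shifts digit positions down by \<open>n\<close>, so the
  nonzero positions of \<open>a\<close> are those below \<open>n\<close> together with the translate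
  by \<open>n\<close> of those of the quotient.\<close>

lemma digit_sum_split:
  assumes "2 \<le> B"
  shows "digit_sum B a = (\<Sum>j<n. digit B a j) + digit_sum B (a div B ^ n)"
proof -
  let ?L = "{j. j < n \<and> digit B a j \<noteq> 0}" and ?H = "{j. digit B (a div B ^ n) j \<noteq> 0}"
  have "j \<in> (+) n ` ?H" if "digit B a j \<noteq> 0" "\<not> j < n" for j
    using that by (intro image_eqI[of _ _ "j - n"]) (auto simp: digit_div_power)
  then have supp: "{j. digit B a j \<noteq> 0} = ?L \<union> (+) n ` ?H"
    by (auto simp: digit_div_power)
  have "finite ?H"
    using assms by (rule finite_digit_support)
  then have "digit_sum B a = (\<Sum>j\<in>?L. digit B a j) + (\<Sum>j\<in>(+) n ` ?H. digit B a j)"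
    unfolding digit_sum_def supp by (intro sum.union_disjoint) auto
  moreover have "(\<Sum>j\<in>?L. digit B a j) = (\<Sum>j<n. digit B a j)"
    by (rule sum.mono_neutral_left) auto
  moreover have "(\<Sum>j\<in>(+) n ` ?H. digit B a j) = digit_sum B (a div B ^ n)"
    by (simp add: digit_sum_def sum.reindex digit_div_power)
  ultimately show ?thesis by simp
qed

lemma sum_div_power_eq_columns:
  "(\<Sum>i\<in>I. a i div B ^ n) = (\<Sum>i\<in>I. digit B (a i) n) + B * (\<Sum>i\<in>I. a i div B ^ Suc n)"
  unfolding sum_distrib_left sum.distrib[symmetric]
  by (rule sum.cong[OF refl]) (rule div_power_eq_digit_plus)

text \<open>The carry is exactly what is lost by truncating the summands before adding instead of
  after. In the induction, one more division by \<open>B\<close> turns column digits plus incoming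
  carry into the next carry; the rest is a multiple of \<open>B\<close> and divides exactly.\<close>

lemma sum_div_power_Suc:
  assumes "0 < B"
  shows "(\<Sum>i=1..r. a i) div B ^ Suc n = (\<Sum>i=1..r. a i div B ^ Suc n) + carry B r a n"
proof (induction n)
  case 0
  show ?case
    using sum_div_power_eq_columns[of a B 0 "{1..r}"] assms by simp
next
  case (Suc n)
  have "(\<Sum>i=1..r. a i) div B ^ Suc (Suc n) = (\<Sum>i=1..r. a i) div B ^ Suc n div B"
    by (simp add: div_mult2_eq power_Suc2 del: power_Suc)
  also have "\<dots> = ((\<Sum>i=1..r. digit B (a i) (Suc n)) + carry B r a n
      + B * (\<Sum>i=1..r. a i div B ^ Suc (Suc n))) div B"
    by (simp only: Suc.IH sum_div_power_eq_columns[of a B "Suc n" "{1..r}"] ac_simps)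
  also have "\<dots> = (\<Sum>i=1..r. a i div B ^ Suc (Suc n)) + carry B r a (Suc n)"
    using assms by (simp del: power_Suc)
  finally show ?case .
qed

lemma digit_of_sum_0:
  "digit B (\<Sum>i=1..r. a i) 0 + B * carry B r a 0 = (\<Sum>i=1..r. digit B (a i) 0)"
proof -
  have "digit B (\<Sum>i=1..r. a i) 0 = (\<Sum>i=1..r. digit B (a i) 0) mod B"
    by (simp add: digit_def mod_sum_eq)
  then show ?thesis by simp
qed

text \<open>Modulo \<open>B\<close> the higher columns vanish, so the digit is the remainder, and
  the outgoing carry the quotient, of one and the same number.\<close>

lemma digit_of_sum_Suc:
  assumes "0 < B"
  shows "digit B (\<Sum>i=1..r. a i) (Suc n) + B * carry B r a (Suc n)
           = (\<Sum>i=1..r. digit B (a i) (Suc n)) + carry B r a n"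
proof -
  let ?D = "\<Sum>i=1..r. digit B (a i) (Suc n)"
  have "digit B (\<Sum>i=1..r. a i) (Suc n) = ((\<Sum>i=1..r. a i div B ^ Suc n) + carry B r a n) mod B"
    by (simp only: digit_def sum_div_power_Suc[OF assms])
  also have "\<dots> = (B * (\<Sum>i=1..r. a i div B ^ Suc (Suc n)) + (?D + carry B r a n)) mod B"
    by (simp only: sum_div_power_eq_columns[of a B "Suc n" "{1..r}"] ac_simps)
  also have "\<dots> = (?D + carry B r a n) mod B"
    by (rule mod_mult_self4)
  finally show ?thesis by simp
qed

text \<open>Passing to column \<open>Suc n\<close>, the incoming carry cancels the term
  \<open>- int (carry B r a n)\<close>, and the \<open>B\<close> copies of the outgoing carry split
  into one new boundary term and \<open>B - 1\<close> for the carry sum.\<close>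

lemma sum_digits_telescope:
  assumes "0 < B"
  shows "(\<Sum>j\<le>n. int (digit B (\<Sum>i=1..r. a i) j))
           = (\<Sum>j\<le>n. \<Sum>i=1..r. int (digit B (a i) j))
             - int (carry B r a n) - (int B - 1) * (\<Sum>j\<le>n. int (carry B r a j))"
proof (induction n)
  case 0
  show ?case
    using arg_cong[OF digit_of_sum_0[of B a r], of int]
    by (simp add: algebra_simps del: carry.simps)
next
  case (Suc n)
  show ?case
    using Suc.IH arg_cong[OF digit_of_sum_Suc[OF assms, of a r n], of int]
    by (simp add: algebra_simps del: carry.simps)
qed

lemma div_power_top_exponent:
  assumes "2 \<le> B" and "i \<in> {1..r}"
  shows "a i div B ^ Suc (top_exponent B r a) = 0"
proof (rule eq_0_if_digits_eq_0[OF assms(1)])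
  fix j
  let ?J = "{j. \<exists>i\<in>{1..r}. digit B (a i) j \<noteq> 0}"
  let ?k = "Suc (top_exponent B r a) + j"
  have "digit B (a i) ?k = 0"
  \<comment> \<open>If all summands are 0, the exponent is the default 0 and not a maximum, so
    \<open>Max_ge\<close> serves only the other case.\<close>
  proof (cases "\<forall>i\<in>{1..r}. a i = 0")
    case True
    then show ?thesis using assms(2) by (simp add: digit_def)
  next
    case False
    then have top: "top_exponent B r a = Max ?J"
      unfolding top_exponent_def by (rule if_not_P)
    have "?J = (\<Union>i\<in>{1..r}. {j. digit B (a i) j \<noteq> 0})"
      by auto
    then have "finite ?J"
      using finite_digit_support[OF assms(1)] by simp
    then have "k \<in> ?J \<Longrightarrow> k \<le> top_exponent B r a" for k
      unfolding top by (rule Max_ge)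
    from this[of ?k] have "?k \<notin> ?J" by linarith
    then show ?thesis using assms(2) by blast
  qed
  then show "digit B (a i div B ^ Suc (top_exponent B r a)) j = 0"
    by (simp only: digit_div_power)
qed

theorem theorem1p3:
  fixes B r :: nat and a :: "nat \<Rightarrow> nat"
  assumes "B \<ge> 2"
  shows "int (digit_sum B (\<Sum>i=1..r. a i))
           = (\<Sum>i=1..r. int (digit_sum B (a i))) - carry_hat B r a"
proof -
  let ?t = "top_exponent B r a" and ?S = "\<Sum>i=1..r. a i"
  have pos: "0 < B" using assms by simp
  \<comment> \<open>No summand reaches column \<open>Suc ?t\<close>, so only the carry remains of
    the quotient.\<close>
  have "?S div B ^ Suc ?t = terminal_carry B r a"
    using sum_div_power_Suc[OF pos, of a r ?t] div_power_top_exponent[OF assms]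
    by (simp add: terminal_carry_def del: power_Suc)
  then have S: "int (digit_sum B ?S)
      = (\<Sum>j\<le>?t. int (digit B ?S j)) + int (digit_sum B (terminal_carry B r a))"
    using digit_sum_split[OF assms, of ?S "Suc ?t"]
    by (simp add: lessThan_Suc_atMost del: power_Suc sum.lessThan_Suc)
  \<comment> \<open>All summands are expanded over the same columns, whatever their own length, so
    that the two sums can be swapped.\<close>
  have "digit_sum B (a i) = (\<Sum>j\<le>?t. digit B (a i) j)" if "i \<in> {1..r}" for i
    using digit_sum_split[OF assms, of "a i" "Suc ?t"] div_power_top_exponent[OF assms that, of a]
    by (simp add: lessThan_Suc_atMost digit_sum_def digit_def del: power_Suc sum.lessThan_Suc)
  then have "(\<Sum>i=1..r. int (digit_sum B (a i))) = (\<Sum>i=1..r. \<Sum>j\<le>?t. int (digit B (a i) j))"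
    by simp
  also have "\<dots> = (\<Sum>j\<le>?t. \<Sum>i=1..r. int (digit B (a i) j))"
    by (rule sum.swap)
  finally show ?thesis
    using S sum_digits_telescope[OF pos, of a r ?t]
    by (simp add: carry_hat_def carry_sum_def terminal_carry_def atMost_atLeast0)
qed

end
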